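(* Let $\{\mathscr{A}_i\}_{i\in I}$ be an arbitrary family of arithmetic varieties. Then the intersection $\bigcap_{i\in I}\mathscr{A}_i$, i.e. the family of all numerical semigroups that belong to $\mathscr{A}_i$ for every $i\in I$, is an arithmetic variety.
   Context: $\mathbb{N}$ denotes the set of non-negative integers. A numerical semigroup is a subset $S\subseteq\mathbb{N}$ containing $0$, closed under addition, with $\mathbb{N}\setminus S$ finite. For numerical semigroups $S,T$, $T$ is an arithmetic extension of $S$ if there exist positive integers $d_1,\dots,d_n$ ($n\ge 1$) such that $T=\{x\in\mathbb{N}\mid \{d_1x,\dots,d_nx\}\subset S\}$. An arithmetic variety is a non-empty family $\mathscr{A}$ of numerical semigroups such that (a) if $S,T\in\mathscr{A}$ then $S\cap T\in\mathscr{A}$; (b) if $S\in\mathscr{A}$ and $T$ is an arithmetic extension of $S$, then $T\in\mathscr{A}$. *)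

theory Defs
  imports Main
begin

definition numerical_semigroup :: "nat set \<Rightarrow> bool" where
  "numerical_semigroup S \<longleftrightarrow>
     0 \<in> S \<and> (\<forall>x\<in>S. \<forall>y\<in>S. x + y \<in> S) \<and> finite (UNIV - S)"

definition arithmetic_extension :: "nat set \<Rightarrow> nat set \<Rightarrow> bool" where
  "arithmetic_extension S T \<longleftrightarrow>
     numerical_semigroup S \<and> numerical_semigroup T \<and>
     (\<exists>(n::nat) (d::nat \<Rightarrow> nat). n \<ge> 1 \<and> (\<forall>i\<in>{1..n}. d i > 0) \<and>
        T = {x. (\<lambda>i. d i * x) ` {1..n} \<subseteq> S})"

text \<open>\<open>arithmetic_extension S T\<close> reads: \<open>T\<close> is an arithmetic extension of \<open>S\<close>.\<close>

definition arithmetic_variety :: "nat set set \<Rightarrow> bool" where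
  "arithmetic_variety \<A> \<longleftrightarrow>
     \<A> \<noteq> {} \<and> (\<forall>S\<in>\<A>. numerical_semigroup S) \<and>
     (\<forall>S\<in>\<A>. \<forall>T\<in>\<A>. S \<inter> T \<in> \<A>) \<and>
     (\<forall>S\<in>\<A>. \<forall>T. arithmetic_extension S T \<longrightarrow> T \<in> \<A>)"

end

theory Submission
  imports Defs
begin

text \<open>
  Both closure conditions are inherited by any intersection; what needs an argument is
  that the intersection is non-empty. All arithmetic varieties share the member
  \<open>\<nat>\<close>: a numerical semigroup \<open>S\<close> contains some \<open>d > 0\<close>, hence
  every multiple of \<open>d\<close>, so \<open>\<nat> = {x. d * x \<in> S}\<close> is an arithmetic extension of
  \<open>S\<close>. Being a numerical semigroup, \<open>\<nat>\<close> also witnesses non-emptiness for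
  the empty index set, where the intersection is the family of all numerical semigroups.
\<close>

lemma numerical_semigroup_UNIV: "numerical_semigroup UNIV"
  by (simp add: numerical_semigroup_def)

lemma numerical_semigroup_Int:
  assumes "numerical_semigroup S" "numerical_semigroup T"
  shows "numerical_semigroup (S \<inter> T)"
  using assms by (auto simp: numerical_semigroup_def Diff_Int)

lemma numerical_semigroup_mult_mem:
  assumes "numerical_semigroup S" "d \<in> S"
  shows "d * x \<in> S"
  using assms by (induction x) (auto simp: numerical_semigroup_def)

lemma numerical_semigroup_pos_element:
  assumes "numerical_semigroup S"
  obtains d where "d \<in> S" "d > 0"
proof -
  have "infinite S"
    using assms finite_Diff2[of S UNIV] by (auto simp: numerical_semigroup_def)
  then have "\<not> S \<subseteq> {0}"
    using finite_subset by blast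
  then show thesis
    using that by blast
qed

lemma arithmetic_extension_UNIV:
  assumes "numerical_semigroup S"
  shows "arithmetic_extension S UNIV"
proof -
  obtain d where d: "d \<in> S" "d > 0"
    using assms by (rule numerical_semigroup_pos_element)
  have "UNIV = {x. (\<lambda>i. d * x) ` {1..1::nat} \<subseteq> S}"
    using numerical_semigroup_mult_mem[OF assms d(1)] by auto
  then have "\<exists>(n::nat) e. n \<ge> 1 \<and> (\<forall>i\<in>{1..n}. e i > 0) \<and>
      UNIV = {x. (\<lambda>i. e i * x) ` {1..n} \<subseteq> S}"
    using d(2) by (intro exI[of _ 1] exI[of _ "\<lambda>_. d"]) simp
  with assms show ?thesis
    by (simp add: arithmetic_extension_def numerical_semigroup_UNIV)
qed

lemma arithmetic_variety_UNIV_mem: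
  assumes "arithmetic_variety \<A>"
  shows "UNIV \<in> \<A>"
  using assms arithmetic_extension_UNIV unfolding arithmetic_variety_def by blast

theorem proposition3:
  fixes I :: "'i set" and \<A> :: "'i \<Rightarrow> nat set set"
  assumes "\<And>i. i \<in> I \<Longrightarrow> arithmetic_variety (\<A> i)"
  shows "arithmetic_variety {S. numerical_semigroup S \<and> (\<forall>i\<in>I. S \<in> \<A> i)}"
    (is "arithmetic_variety ?B")
proof -
  have "UNIV \<in> ?B"
    using assms numerical_semigroup_UNIV arithmetic_variety_UNIV_mem by blast
  then have "?B \<noteq> {}"
    by blast
  moreover have "S \<inter> T \<in> ?B" if "S \<in> ?B" "T \<in> ?B" for S T
    using that assms numerical_semigroup_Int by (simp add: arithmetic_variety_def)
  moreover have "T \<in> ?B" if "S \<in> ?B" "arithmetic_extension S T" for S T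
  proof -
    have "numerical_semigroup T"
      using that(2) by (simp add: arithmetic_extension_def)
    moreover have "T \<in> \<A> i" if "i \<in> I" for i
      using that \<open>S \<in> ?B\<close> \<open>arithmetic_extension S T\<close> assms[OF that]
      unfolding arithmetic_variety_def by blast
    ultimately show ?thesis
      by blast
  qed
  ultimately show ?thesis
    unfolding arithmetic_variety_def by blast
qed

end
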